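(* As formal power series in $u$, \[ \sum_{n=0}^\infty P_{n}^{(\mathrm{pk},\mathrm{ipk})}(s,t) u^n = \sum_{k=0}^\infty \frac{1}{k!} \left(\frac{L\big(\sqrt{(1-s)(1-t)}\,u\big)}{\sqrt{(1-s)(1-t)}}\right)^k P_{k}^{\mathrm{pk}}(s)P_{k}^{\mathrm{pk}}(t), \] where $L(u)=\frac12\log\frac{1+u}{1-u}=\sum_{m\ge1}\frac{u^{2m-1}}{2m-1}$.
   Context: $\mathfrak{S}_n$ is the symmetric group on $[n]$. For $\pi\in\mathfrak{S}_n$, an index $i$ with $2\le i\le n-1$ is a peak if $\pi(i-1)<\pi(i)>\pi(i+1)$; $\mathrm{pk}(\pi)$ is the number of peaks and $\mathrm{ipk}(\pi)=\mathrm{pk}(\pi^{-1})$. For $n\ge1$, $P_{n}^{(\mathrm{pk},\mathrm{ipk})}(s,t)=\sum_{\pi\in\mathfrak{S}_{n}}s^{\mathrm{pk}(\pi)+1}t^{\mathrm{ipk}(\pi)+1}$ and $P_n^{\mathrm{pk}}(t)=\sum_{\pi\in\mathfrak{S}_n}t^{\mathrm{pk}(\pi)+1}$; by convention $P_{0}^{(\mathrm{pk},\mathrm{ipk})}(s,t)=1$ and $P_0^{\mathrm{pk}}(t)=1$. *)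

theory Defs
  imports
    "HOL-Combinatorics.Permutations"
    "HOL-Computational_Algebra.Formal_Power_Series"
begin

text \<open>
  The elements of the symmetric group on $[n]$ are the functions that permute \<open>{1..n}\<close>;
  since these are the identity outside \<open>{1..n}\<close>, the degree \<open>n\<close> is passed explicitly.
\<close>

definition pk :: "nat \<Rightarrow> (nat \<Rightarrow> nat) \<Rightarrow> nat" where
  "pk n \<pi> = card {i \<in> {2..n - 1}. \<pi> (i - 1) < \<pi> i \<and> \<pi> i > \<pi> (i + 1)}"

definition ipk :: "nat \<Rightarrow> (nat \<Rightarrow> nat) \<Rightarrow> nat" where
  "ipk n \<pi> = pk n (inv \<pi>)"

definition P_pk :: "nat \<Rightarrow> 'a::comm_ring_1 \<Rightarrow> 'a" where
  "P_pk n t = (if n = 0 then 1 else \<Sum>\<pi> | \<pi> permutes {1..n}. t ^ (pk n \<pi> + 1))"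

definition P_pk_ipk :: "nat \<Rightarrow> 'a::comm_ring_1 \<Rightarrow> 'a \<Rightarrow> 'a" where
  "P_pk_ipk n s t =
    (if n = 0 then 1
     else \<Sum>\<pi> | \<pi> permutes {1..n}. s ^ (pk n \<pi> + 1) * t ^ (ipk n \<pi> + 1))"

definition L_fps :: "'a::field_char_0 fps" where
  "L_fps = Abs_fps (\<lambda>n. if odd n then 1 / of_nat n else 0)"

text \<open>
  The closed form of the series above: \<open>fps_ln 1\<close> is the series of $\log(1+u)$, so
  $\log\frac{1+u}{1-u}$ is its composition with $\frac{1+u}{1-u}-1$.
\<close>

lemma L_fps_eq_log:
  includes fps_syntax
  shows
  "(L_fps :: 'a::field_char_0 fps) =
     fps_const (1/2) * (fps_ln 1 oo ((1 + fps_X) / (1 - fps_X) - 1))"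
proof -
  define D :: "'a fps" where "D = inverse (1 - fps_X)"
  have D: "D * (1 - fps_X) = 1"
    unfolding D_def by (rule inverse_mult_eq_1) simp
  define g :: "'a fps" where "g = (1 + fps_X) / (1 - fps_X) - 1"
  have gD: "g = (1 + fps_X) * D - 1"
    unfolding g_def D_def by (subst fps_divide_unit) simp_all
  have D': "fps_deriv D = D * D"
    unfolding D_def by (subst fps_inverse_deriv) (simp_all add: power2_eq_square)
  have g0: "g $ 0 = 0"
    by (simp add: gD D_def)
  have g': "fps_deriv g = D + (1 + fps_X) * (D * D)"
    by (simp add: gD D' algebra_simps)
  have "inverse (1 + fps_X) oo g = inverse (1 + g)"
    using g0 by (subst fps_inverse_compose) (simp_all add: fps_compose_add_distrib)
  then have der: "fps_deriv (fps_ln 1 oo g) = inverse (1 + g) * fps_deriv g"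
    using g0 by (simp add: fps_compose_deriv fps_ln_deriv)
  have u: "(1 + g) * inverse (1 + g) = 1"
    using g0 by (simp add: inverse_mult_eq_1')
  have "(1 - fps_X\<^sup>2) * fps_deriv L_fps = (1 :: 'a fps)"
  proof (rule fps_ext)
    fix n
    show "((1 - fps_X\<^sup>2) * fps_deriv L_fps) $ n = (1 :: 'a fps) $ n"
      by (cases "n < 2")
         (auto simp: L_fps_def algebra_simps fps_X_power_mult_nth less_2_cases_iff
               simp del: of_nat_Suc)
  qed
  moreover have "(1 - fps_X\<^sup>2) * (fps_const (1/2) * (inverse (1 + g) * fps_deriv g)) = (1::'a fps)"
  proof -
    define I where "I = inverse (1 + g)"
    have I: "(1 + fps_X) * D * I = 1"
      using u by (simp add: gD I_def)
    have "(1 - fps_X\<^sup>2) * (I * fps_deriv g) = 2"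
      using I D unfolding g' by algebra
    then have "fps_const (1/2) * ((1 - fps_X\<^sup>2) * (I * fps_deriv g)) = fps_const (1/2) * 2"
      by simp
    also have "fps_const (1/2) * 2 = (1 :: 'a fps)"
      by (simp add: numeral_fps_const)
    finally show ?thesis
      by (simp add: I_def mult.left_commute)
  qed
  moreover have "(1 - fps_X\<^sup>2 :: 'a fps) \<noteq> 0"
  proof
    assume "1 - fps_X\<^sup>2 = (0 :: 'a fps)"
    then have "(1 - fps_X\<^sup>2 :: 'a fps) $ 0 = 0 $ 0" by simp
    then show False by simp
  qed
  ultimately have "fps_deriv L_fps = fps_const (1/2) * (inverse (1 + g) * fps_deriv g)"
    by (metis mult_left_cancel)
  then have "fps_deriv L_fps = fps_deriv (fps_const (1/2) * (fps_ln 1 oo g))"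
    by (simp add: der)
  moreover have "L_fps $ 0 = (fps_const (1/2) * (fps_ln 1 oo g)) $ 0"
    by (simp add: L_fps_def)
  ultimately have "L_fps = fps_const (1/2) * (fps_ln 1 oo g)"
    by (subst (asm) fps_deriv_eq_iff) simp
  then show ?thesis by (simp add: g_def)
qed

end

theory Submission
  imports Defs "HOL-Computational_Algebra.Polynomial_FPS" "HOL-Library.FuncSet"
begin

text \<open>
  The proof counts Stembridge's enriched $P$-partitions. For a permutation $\pi$ of $[n]$ let
  $\Omega_\pi(m)$ be the number of weakly increasing words $g_1 \le \dots \le g_n$ in the letters
  $-1 < +1 < \dots < -m < +m$ in which a positive (negative) letter may be repeated only at an ascent
  (descent) of $\pi$. A transfer computation gives
  $\sum_m \Omega_\pi(m) x^m = \frac12 R^{n+1} T^{\mathrm{pk}(\pi)+1}$ with $R = \frac{1+x}{1-x}$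
  and $T = \frac{4x}{(1+x)^2}$, so that $R^2 (1 - T) = 1$.

  Signed standardization of words gives $\sum_\pi \Omega_\pi(m) = (2m)^n$. It also shows that
  $\sum_\pi \Omega_\pi(a)\,\Omega_{\pi^{-1}}(b)$ counts chains in a totally ordered set of $4ab$
  pairs of letters, of which exactly half, the pairs of equal sign, may be repeated. Hence this sum is
  the coefficient of $u^n$ in $\left(\frac{1+u}{1-u}\right)^{2ab} = \exp(4ab\,L(u))$, that is
  $\sum_k \frac{1}{k!} [u^n]L(u)^k (2a)^k (2b)^k$. Passing to generating functions in $a$ and in $b$
  and cancelling $R^{n+1}$ turns $(2a)^k$ into $(1-s)^{(n-k)/2} P_k^{\mathrm{pk}}(s)$ and likewise
  for $b$ and $t$; the substitution $s = T$ loses nothing because $T$ is transcendental.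
\<close>

unbundle fps_syntax

section \<open>Words with restricted repetitions\<close>

text \<open>\<open>E i c\<close> licenses the letter \<open>c\<close> to stand at both positions
  \<open>i\<close> and \<open>i + 1\<close>. Words are extensional, so that counting functions
  counts words.\<close>

definition chains :: "(nat \<Rightarrow> nat \<Rightarrow> bool) \<Rightarrow> nat \<Rightarrow> nat \<Rightarrow> (nat \<Rightarrow> nat) set" where
  "chains E n N = {g \<in> {1..n} \<rightarrow>\<^sub>E {..<N}.
     \<forall>i\<in>{1..<n}. g i < g (Suc i) \<or> g i = g (Suc i) \<and> E i (g i)}"

text \<open>The alphabet size drops out because earlier letters are at most \<open>c\<close>. The
  value 0 at length 0, where there is no last letter, makes the recursions between generating
  functions hold from the constant term on.\<close>

fun chains_ending :: "(nat \<Rightarrow> nat \<Rightarrow> bool) \<Rightarrow> nat \<Rightarrow> nat \<Rightarrow> nat" where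
  "chains_ending E 0 c = 0"
| "chains_ending E (Suc 0) c = 1"
| "chains_ending E (Suc (Suc n)) c =
     (\<Sum>b<c. chains_ending E (Suc n) b) + (if E (Suc n) c then chains_ending E (Suc n) c else 0)"

lemma finite_chains: "finite (chains E n N)"
  by (rule finite_subset[of _ "{1..n} \<rightarrow>\<^sub>E {..<N}"]) (auto simp: chains_def intro: finite_PiE)

lemma chains_Suc_Suc:
  assumes "c < N"
  shows "{g \<in> chains E (Suc (Suc n)) N. g (Suc (Suc n)) = c} =
    (\<lambda>g. g(Suc (Suc n) := c)) `
      {g \<in> chains E (Suc n) N. g (Suc n) < c \<or> g (Suc n) = c \<and> E (Suc n) c}"
    (is "?L = ?f ` ?R")
proof
  show "?L \<subseteq> ?f ` ?R"
  proof
    fix g assume g: "g \<in> ?L"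
    define g' where "g' = restrict g {1..Suc n}"
    have "g' \<in> ?R"
      using g by (auto simp: g'_def chains_def)
    moreover have "?f g' = g"
    proof
      fix i
      have "g i = undefined" if "i \<notin> {1..Suc (Suc n)}"
        using g that by (auto simp: chains_def dest: PiE_arb)
      then show "?f g' i = g i"
        using g by (auto simp: g'_def)
    qed
    ultimately show "g \<in> ?f ` ?R" by (intro image_eqI[of g ?f g']) simp_all
  qed
next
  show "?f ` ?R \<subseteq> ?L"
  proof (rule image_subsetI)
    fix g assume g: "g \<in> ?R"
    then have P: "g \<in> {1..Suc n} \<rightarrow>\<^sub>E {..<N}" by (simp add: chains_def)
    have "?f g \<in> {1..Suc (Suc n)} \<rightarrow>\<^sub>E {..<N}"
    proof (rule PiE_I)
      fix i assume "i \<in> {1..Suc (Suc n)}"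
      then show "?f g i \<in> {..<N}"
        using P assms by (cases "i = Suc (Suc n)") (auto dest: PiE_mem)
    next
      fix i assume "i \<notin> {1..Suc (Suc n)}"
      then show "?f g i = undefined"
        using PiE_arb[OF P, of i] by auto
    qed
    moreover have "?f g i < ?f g (Suc i) \<or> ?f g i = ?f g (Suc i) \<and> E i (?f g i)"
      if "i \<in> {1..<Suc (Suc n)}" for i
      using g that by (cases "i = Suc n") (auto simp: chains_def)
    ultimately show "?f g \<in> ?L" by (simp add: chains_def)
  qed
qed

lemma card_eq_sum_fibres:
  assumes "finite A" "finite B"
  shows "card {x \<in> A. f x \<in> B} = (\<Sum>b\<in>B. card {x \<in> A. f x = b})"
proof -
  have "{x \<in> A. f x \<in> B} = (\<Union>b\<in>B. {x \<in> A. f x = b})" by auto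
  also have "card \<dots> = (\<Sum>b\<in>B. card {x \<in> A. f x = b})"
    by (rule card_UN_disjoint) (use assms in auto)
  finally show ?thesis .
qed

lemma card_chains_ending:
  "c < N \<Longrightarrow> card {g \<in> chains E (Suc n) N. g (Suc n) = c} = chains_ending E (Suc n) c"
proof (induction n arbitrary: c)
  case 0
  have "{g \<in> chains E (Suc 0) N. g (Suc 0) = c} = {\<lambda>i\<in>{Suc 0}. c}"
    using 0 by (auto simp: chains_def PiE_iff extensional_def fun_eq_iff)
  then show ?case by simp
next
  case (Suc n)
  define B where "B = {..<c} \<union> (if E (Suc n) c then {c} else {})"
  have inj: "inj_on (\<lambda>g. g(Suc (Suc n) := c)) (chains E (Suc n) N)"
  proof (rule inj_onI)
    fix g h assume gh: "g \<in> chains E (Suc n) N" "h \<in> chains E (Suc n) N"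
      and eq: "g(Suc (Suc n) := c) = h(Suc (Suc n) := c)"
    show "g = h"
    proof
      fix i
      \<comment> \<open>The overwritten position carries \<open>undefined\<close> in both words, so
        the update loses no information.\<close>
      have "g (Suc (Suc n)) = undefined" "h (Suc (Suc n)) = undefined"
        using gh by (auto simp: chains_def PiE_iff extensional_def)
      then show "g i = h i"
        using fun_cong[OF eq, of i] by (cases "i = Suc (Suc n)") auto
    qed
  qed
  have "card {g \<in> chains E (Suc (Suc n)) N. g (Suc (Suc n)) = c} =
      card {g \<in> chains E (Suc n) N. g (Suc n) < c \<or> g (Suc n) = c \<and> E (Suc n) c}"
    unfolding chains_Suc_Suc[OF Suc.prems]
    by (rule card_image) (rule inj_on_subset[OF inj], auto)
  also have "{g \<in> chains E (Suc n) N. g (Suc n) < c \<or> g (Suc n) = c \<and> E (Suc n) c} =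
      {g \<in> chains E (Suc n) N. g (Suc n) \<in> B}"
    by (auto simp: B_def)
  also have "card \<dots> = (\<Sum>b\<in>B. card {g \<in> chains E (Suc n) N. g (Suc n) = b})"
    by (rule card_eq_sum_fibres) (auto simp: finite_chains B_def)
  also have "\<dots> = (\<Sum>b\<in>B. chains_ending E (Suc n) b)"
    by (rule sum.cong) (use Suc in \<open>auto simp: B_def split: if_splits\<close>)
  also have "\<dots> = chains_ending E (Suc (Suc n)) c"
    by (auto simp: B_def)
  finally show ?case .
qed

lemma card_chains:
  "card (chains E (Suc n) N) = (\<Sum>c<N. chains_ending E (Suc n) c)"
proof -
  have "chains E (Suc n) N = {g \<in> chains E (Suc n) N. g (Suc n) \<in> {..<N}}"
    by (auto simp: chains_def)
  then have "card (chains E (Suc n) N) =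
      (\<Sum>c\<in>{..<N}. card {g \<in> chains E (Suc n) N. g (Suc n) = c})"
    using card_eq_sum_fibres[OF finite_chains, of "{..<N}" E "Suc n" N "\<lambda>g. g (Suc n)"] by simp
  also have "\<dots> = (\<Sum>c<N. chains_ending E (Suc n) c)"
    by (rule sum.cong) (auto simp: card_chains_ending)
  finally show ?thesis .
qed

lemma card_chains_0: "card (chains E 0 N) = 1"
  by (simp add: chains_def)

definition chains_gf :: "(nat \<Rightarrow> bool) \<Rightarrow> nat \<Rightarrow> 'a::field_char_0 fps" where
  "chains_gf e N = Abs_fps (\<lambda>n. of_nat (card (chains (\<lambda>_. e) n N)))"

text \<open>A chain over one more letter is a chain over the old ones followed by copies of the new
  largest letter \<open>N\<close>: any number if it may be repeated, at most one otherwise.\<close>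

lemma chains_gf_Suc:
  "chains_gf e (Suc N) =
     (if e N then inverse (1 - fps_X) else 1 + fps_X) * (chains_gf e N :: 'a::field_char_0 fps)"
proof -
  define V where "V = (chains_gf e N :: 'a fps)"
  define M where "M = Abs_fps (\<lambda>n. of_nat (chains_ending (\<lambda>_. e) n N) :: 'a)"
  have V': "chains_gf e (Suc N) = V + M"
  proof (rule fps_ext)
    fix n show "(chains_gf e (Suc N) :: 'a fps) $ n = (V + M) $ n"
      by (cases n) (simp_all add: chains_gf_def V_def M_def card_chains card_chains_0)
  qed
  \<comment> \<open>\<open>M\<close> counts the chains that end in \<open>N\<close>. Deleting this
    letter leaves a chain over smaller letters or, if \<open>N\<close> may be repeated, another
    chain counted by \<open>M\<close>.\<close>
  have M: "M = fps_X * V + (if e N then fps_X * M else 0)"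
  proof (rule fps_ext)
    fix n show "M $ n = (fps_X * V + (if e N then fps_X * M else 0)) $ n"
    proof (cases n)
      case (Suc k)
      then show ?thesis
        by (cases k) (simp_all add: chains_gf_def V_def M_def card_chains card_chains_0)
    qed (simp add: M_def)
  qed
  show ?thesis
  proof (cases "e N")
    case True
    have D: "(1 - fps_X) * inverse (1 - fps_X) = (1 :: 'a fps)"
      by (rule inverse_mult_eq_1') simp
    from M True have "(1 - fps_X) * (V + M) = V"
      by (simp add: algebra_simps)
    then have "inverse (1 - fps_X) * V = ((1 - fps_X) * inverse (1 - fps_X)) * (V + M)"
      by (metis mult.assoc mult.commute)
    then show ?thesis using V' True D by (simp add: V_def)
  next
    case False
    then show ?thesis using M V' by (simp add: V_def algebra_simps)
  qed
qed

lemma chains_gf_odd: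
  "chains_gf odd (2 * m) = (((1 + fps_X) * inverse (1 - fps_X)) ^ m :: 'a::field_char_0 fps)"
proof (induction m)
  case 0
  show ?case
  proof (rule fps_ext)
    fix n
    show "(chains_gf odd (2 * 0) :: 'a fps) $ n = (((1 + fps_X) * inverse (1 - fps_X)) ^ 0) $ n"
      by (cases n) (simp_all add: chains_gf_def card_chains card_chains_0)
  qed
next
  case (Suc m)
  have "2 * Suc m = Suc (Suc (2 * m))" by simp
  then show ?case by (simp only: chains_gf_Suc Suc) (simp add: algebra_simps)
qed

section \<open>Signed standardization\<close>

text \<open>The letters $-1 < +1 < -2 < +2 < \dots$ are encoded as $0, 1, 2, 3, \dots$, so the positive
  letters are the odd numbers.\<close>

definition enriched :: "nat \<Rightarrow> (nat \<Rightarrow> nat) \<Rightarrow> nat \<Rightarrow> (nat \<Rightarrow> nat) set" where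
  "enriched n \<sigma> m = chains (\<lambda>i c. odd c \<longleftrightarrow> \<sigma> i < \<sigma> (Suc i)) n (2 * m)"

text \<open>\<open>\<pi>\<close> is the signed standardization of the word \<open>h\<close>: ties are broken from left to right
  for positive letters and from right to left for negative ones.\<close>

definition sorts :: "nat \<Rightarrow> (nat \<Rightarrow> nat) \<Rightarrow> (nat \<Rightarrow> nat) \<Rightarrow> bool" where
  "sorts n \<pi> h \<longleftrightarrow> (\<forall>i\<in>{1..n}. \<forall>j\<in>{1..n}. \<pi> i < \<pi> j \<longleftrightarrow>
     h i < h j \<or> h i = h j \<and> (if odd (h i) then i < j else j < i))"

text \<open>Comparing letters and breaking ties by position is a strict total order on the
  positions, and the only permutation that respects it is the rank function.\<close>

lemma ex1_sorts:
  "\<exists>!\<pi>. \<pi> permutes {1..n} \<and> sorts n \<pi> h"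
proof -
  define R where "R i j \<longleftrightarrow> h i < h j \<or> h i = h j \<and> (if odd (h i) then i < j else j < i)" for i j
  have R_trans: "R i k" if "R i j" "R j k" for i j k
    using that by (auto simp: R_def split: if_splits)
  have R_irrefl: "\<not> R i i" for i by (auto simp: R_def)
  have R_total: "R i j \<or> R j i" if "i \<noteq> j" for i j
    using that by (auto simp: R_def)
  \<comment> \<open>The rank counts \<open>i\<close> itself, so that ranks run from 1 to
    \<open>n\<close>; elsewhere \<open>std\<close> is the identity, as \<open>permutes\<close>
    demands.\<close>
  define std where "std i = (if i \<in> {1..n} then card {j \<in> {1..n}. j = i \<or> R j i} else i)" for i
  have mono: "std i < std j" if "R i j" "i \<in> {1..n}" "j \<in> {1..n}" for i j
  proof -
    have "{k \<in> {1..n}. k = i \<or> R k i} \<subset> {k \<in> {1..n}. k = j \<or> R k j}"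
    proof
      show "{k \<in> {1..n}. k = i \<or> R k i} \<subseteq> {k \<in> {1..n}. k = j \<or> R k j}"
        using that(1) R_trans by auto
      have "j \<noteq> i" "\<not> R j i"
        using that(1) R_irrefl R_trans by blast+
      then show "{k \<in> {1..n}. k = i \<or> R k i} \<noteq> {k \<in> {1..n}. k = j \<or> R k j}"
        using that(3) by blast
    qed
    then have "card {k \<in> {1..n}. k = i \<or> R k i} < card {k \<in> {1..n}. k = j \<or> R k j}"
      by (intro psubset_card_mono) auto
    then show ?thesis using that by (simp add: std_def)
  qed
  have iff: "std i < std j \<longleftrightarrow> R i j" if "i \<in> {1..n}" "j \<in> {1..n}" for i j
    using mono[of i j] mono[of j i] R_total[of i j] that by (cases "i = j") (auto simp: R_irrefl)
  have inj: "inj_on std {1..n}"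
    by (rule inj_onI) (metis R_total iff less_irrefl)
  have "std ` {1..n} \<subseteq> {1..n}"
  proof (rule image_subsetI)
    fix i assume i: "i \<in> {1..n}"
    have "card {j \<in> {1..n}. j = i \<or> R j i} \<le> card {1..n}"
      by (rule card_mono) auto
    moreover have "card {j \<in> {1..n}. j = i \<or> R j i} > 0"
      using i by (auto simp: card_gt_0_iff)
    ultimately show "std i \<in> {1..n}" using i by (simp add: std_def)
  qed
  with inj have "bij_betw std {1..n} {1..n}"
    by (simp add: bij_betw_def endo_inj_surj)
  then have perm: "std permutes {1..n}"
    by (rule bij_imp_permutes) (simp only: std_def if_False)
  show ?thesis
  proof (rule ex1I[of _ std])
    show "std permutes {1..n} \<and> sorts n std h"
      using perm iff by (auto simp: sorts_def R_def)
  next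
    fix \<pi> assume \<pi>: "\<pi> permutes {1..n} \<and> sorts n \<pi> h"
    show "\<pi> = std"
    proof
      fix i
      show "\<pi> i = std i"
      proof (cases "i \<in> {1..n}")
        case True
        have le: "\<pi> j \<le> \<pi> i \<longleftrightarrow> j = i \<or> R j i" if "j \<in> {1..n}" for j
          using \<pi> that True unfolding sorts_def R_def[symmetric]
          by (metis le_less permutes_inj injD)
        \<comment> \<open>A permutation attains each of the values 1 to \<open>\<pi> i\<close>
          exactly once, so \<open>\<pi> i\<close> is the number of positions with value at most
          \<open>\<pi> i\<close>, which is the rank.\<close>
        have "\<pi> ` {j \<in> {1..n}. \<pi> j \<le> \<pi> i} = {1..\<pi> i}"
        proof
          show "{1..\<pi> i} \<subseteq> \<pi> ` {j \<in> {1..n}. \<pi> j \<le> \<pi> i}"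
          proof
            fix k assume k: "k \<in> {1..\<pi> i}"
            moreover have "\<pi> i \<in> {1..n}"
              using \<pi> True permutes_in_image[of \<pi> "{1..n}" i] by blast
            ultimately have "k \<in> \<pi> ` {1..n}" using \<pi> by (auto simp: permutes_image)
            then show "k \<in> \<pi> ` {j \<in> {1..n}. \<pi> j \<le> \<pi> i}" using k by auto
          qed
          show "\<pi> ` {j \<in> {1..n}. \<pi> j \<le> \<pi> i} \<subseteq> {1..\<pi> i}"
            using \<pi> permutes_in_image[of \<pi> "{1..n}"] by fastforce
        qed
        then have "\<pi> i = card (\<pi> ` {j \<in> {1..n}. \<pi> j \<le> \<pi> i})" by simp
        also have "\<dots> = card {j \<in> {1..n}. \<pi> j \<le> \<pi> i}"
          by (rule card_image) (use \<pi> permutes_inj_on in blast)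
        also have "{j \<in> {1..n}. \<pi> j \<le> \<pi> i} = {j \<in> {1..n}. j = i \<or> R j i}"
          using le by auto
        finally show ?thesis using True by (simp add: std_def)
      next
        case False
        then have "\<pi> i = i" by (rule permutes_not_in[OF conjunct1[OF \<pi>]])
        then show ?thesis using False by (simp only: std_def if_False)
      qed
    qed
  qed
qed

text \<open>Reading \<open>h\<close> in the order prescribed by \<open>inv \<pi>\<close> makes
  sorting a condition on neighbours: the chain condition compares consecutive positions, and
  transitivity extends it to all pairs.\<close>

lemma sorts_iff_enriched_inv:
  assumes \<pi>: "\<pi> permutes {1..n}" and h: "h \<in> {1..n} \<rightarrow>\<^sub>E {..<2 * m}"
  shows "sorts n \<pi> h \<longleftrightarrow> restrict (h \<circ> inv \<pi>) {1..n} \<in> enriched n (inv \<pi>) m"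
proof -
  define R where "R i j \<longleftrightarrow> h i < h j \<or> h i = h j \<and> (if odd (h i) then i < j else j < i)" for i j
  have R_trans: "R i k" if "R i j" "R j k" for i j k
    using that by (auto simp: R_def split: if_splits)
  have R_irrefl: "\<not> R i i" for i by (auto simp: R_def)
  have inv_in: "inv \<pi> i \<in> {1..n} \<longleftrightarrow> i \<in> {1..n}" for i
    using permutes_in_image[OF permutes_inv[OF \<pi>]] .
  have inv_inj: "inv \<pi> i = inv \<pi> j \<longleftrightarrow> i = j" for i j
    using permutes_inj[OF permutes_inv[OF \<pi>]] by (auto dest: injD)
  have inv1: "inv \<pi> (\<pi> i) = i" "\<pi> (inv \<pi> i) = i" for i
    using permutes_inverses[OF \<pi>] by auto
  have "restrict (h \<circ> inv \<pi>) {1..n} \<in> {1..n} \<rightarrow>\<^sub>E {..<2 * m}"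
    using h inv_in by (intro restrict_PiE_iff[THEN iffD2] ballI) (metis PiE_mem comp_apply)
  then have "restrict (h \<circ> inv \<pi>) {1..n} \<in> enriched n (inv \<pi>) m \<longleftrightarrow>
      (\<forall>i\<in>{1..<n}. h (inv \<pi> i) < h (inv \<pi> (Suc i)) \<or> h (inv \<pi> i) = h (inv \<pi> (Suc i)) \<and>
         (odd (h (inv \<pi> i)) \<longleftrightarrow> inv \<pi> i < inv \<pi> (Suc i)))"
    by (auto simp: enriched_def chains_def)
  also have "\<dots> \<longleftrightarrow> (\<forall>i\<in>{1..<n}. R (inv \<pi> i) (inv \<pi> (Suc i)))"
  proof (rule ball_cong)
    fix i
    \<comment> \<open>As the two positions differ, a non-ascent is a descent, so the repetition rule
      of \<open>enriched\<close> is the tie rule of \<open>R\<close>.\<close>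
    have "inv \<pi> i \<noteq> inv \<pi> (Suc i)" by (simp add: inv_inj)
    then show "(h (inv \<pi> i) < h (inv \<pi> (Suc i)) \<or> h (inv \<pi> i) = h (inv \<pi> (Suc i)) \<and>
         (odd (h (inv \<pi> i)) \<longleftrightarrow> inv \<pi> i < inv \<pi> (Suc i))) \<longleftrightarrow> R (inv \<pi> i) (inv \<pi> (Suc i))"
      by (auto simp: R_def)
  qed simp
  also have "\<dots> \<longleftrightarrow> (\<forall>i\<in>{1..n}. \<forall>j\<in>{1..n}. i < j \<longrightarrow> R (inv \<pi> i) (inv \<pi> j))"
  proof (intro iffI ballI impI)
    fix i j assume step: "\<forall>i\<in>{1..<n}. R (inv \<pi> i) (inv \<pi> (Suc i))"
      and ij: "i \<in> {1..n}" "j \<in> {1..n}" "i < j"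
    from \<open>i < j\<close> have "Suc i \<le> j" by simp
    then show "R (inv \<pi> i) (inv \<pi> j)"
      using ij(2)
    proof (induction j rule: dec_induct)
      case base
      then show ?case using step ij by auto
    next
      case (step k)
      then show ?case using R_trans[of "inv \<pi> i" "inv \<pi> k" "inv \<pi> (Suc k)"]
        \<open>\<forall>i\<in>{1..<n}. R (inv \<pi> i) (inv \<pi> (Suc i))\<close> ij(1) by auto
    qed
  qed auto
  \<comment> \<open>Being irreflexive and transitive, \<open>R\<close> cannot hold against the order
    once it holds along it, so the implication becomes an equivalence.\<close>
  also have "\<dots> \<longleftrightarrow> (\<forall>i\<in>{1..n}. \<forall>j\<in>{1..n}. i < j \<longleftrightarrow> R (inv \<pi> i) (inv \<pi> j))"
    by (metis R_trans R_irrefl nat_neq_iff)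
  also have "\<dots> \<longleftrightarrow> (\<forall>i\<in>{1..n}. \<forall>j\<in>{1..n}. \<pi> i < \<pi> j \<longleftrightarrow> R i j)"
    by (metis inv1 inv_in)
  finally show ?thesis by (simp add: sorts_def R_def)
qed

lemma card_enriched_inv:
  assumes \<pi>: "\<pi> permutes {1..n}"
  shows "card (enriched n (inv \<pi>) m) = card {h \<in> {1..n} \<rightarrow>\<^sub>E {..<2 * m}. sorts n \<pi> h}"
proof -
  have inv1: "inv \<pi> (\<pi> i) = i" "\<pi> (inv \<pi> i) = i" for i
    using permutes_inverses[OF \<pi>] by auto
  have inv_in: "inv \<pi> i \<in> {1..n} \<longleftrightarrow> i \<in> {1..n}" for i
    using permutes_in_image[OF permutes_inv[OF \<pi>]] .
  have in_iff: "\<pi> i \<in> {1..n} \<longleftrightarrow> i \<in> {1..n}" for i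
    using permutes_in_image[OF \<pi>] .
  have A: "restrict (restrict (h \<circ> inv \<pi>) {1..n} \<circ> \<pi>) {1..n} = h"
    if "h \<in> {1..n} \<rightarrow>\<^sub>E {..<2 * m}" for h
    using that in_iff by (auto simp: fun_eq_iff inv1 PiE_iff extensional_def restrict_def)
  have B: "restrict (restrict (g \<circ> \<pi>) {1..n} \<circ> inv \<pi>) {1..n} = g"
    if "g \<in> {1..n} \<rightarrow>\<^sub>E {..<2 * m}" for g
    using that inv_in by (auto simp: fun_eq_iff inv1 PiE_iff extensional_def restrict_def)
  have C: "restrict (g \<circ> \<pi>) {1..n} \<in> {1..n} \<rightarrow>\<^sub>E {..<2 * m}" if "g \<in> {1..n} \<rightarrow>\<^sub>E {..<2 * m}" for g
    using that in_iff by (intro restrict_PiE_iff[THEN iffD2] ballI) (metis PiE_mem comp_apply)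
  have D: "g \<in> {1..n} \<rightarrow>\<^sub>E {..<2 * m}" if "g \<in> enriched n \<sigma> m" for g \<sigma>
    using that by (simp add: enriched_def chains_def)
  have "bij_betw (\<lambda>h. restrict (h \<circ> inv \<pi>) {1..n})
      {h \<in> {1..n} \<rightarrow>\<^sub>E {..<2 * m}. sorts n \<pi> h} (enriched n (inv \<pi>) m)"
  proof (rule bij_betw_byWitness[where f' = "\<lambda>g. restrict (g \<circ> \<pi>) {1..n}"])
    show "(\<lambda>g. restrict (g \<circ> \<pi>) {1..n}) ` enriched n (inv \<pi>) m
        \<subseteq> {h \<in> {1..n} \<rightarrow>\<^sub>E {..<2 * m}. sorts n \<pi> h}"
    proof (rule image_subsetI)
      fix g assume g: "g \<in> enriched n (inv \<pi>) m"
      then have "sorts n \<pi> (restrict (g \<circ> \<pi>) {1..n})"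
        by (subst sorts_iff_enriched_inv[OF \<pi> C[OF D]]) (simp_all only: B[OF D])
      with C[OF D[OF g]]
      show "restrict (g \<circ> \<pi>) {1..n} \<in> {h \<in> {1..n} \<rightarrow>\<^sub>E {..<2 * m}. sorts n \<pi> h}" by simp
    qed
  qed (use A B D sorts_iff_enriched_inv[OF \<pi>] in auto)
  then show ?thesis by (rule bij_betw_same_card[symmetric])
qed

text \<open>Every word is sorted by exactly one permutation, so the double sum over permutations and
  words collapses to a sum over words. The weight may be any quantity that can be read off from the
  word.\<close>

lemma sum_card_enriched_inv:
  fixes F :: "(nat \<Rightarrow> nat) \<Rightarrow> nat"
  assumes "\<And>\<pi> h. \<pi> permutes {1..n} \<Longrightarrow> sorts n \<pi> h \<Longrightarrow> F \<pi> = G h"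
  shows "(\<Sum>\<pi> | \<pi> permutes {1..n}. F \<pi> * card (enriched n (inv \<pi>) m)) =
    (\<Sum>h\<in>{1..n} \<rightarrow>\<^sub>E {..<2 * m}. G h)"
proof -
  let ?W = "{1..n} \<rightarrow>\<^sub>E {..<2 * m}"
  have fin: "finite ?W" by (rule finite_PiE) auto
  have finP: "finite {\<pi>. \<pi> permutes {1..n}}" by (rule finite_permutations) simp
  have "(\<Sum>\<pi> | \<pi> permutes {1..n}. F \<pi> * card (enriched n (inv \<pi>) m)) =
      (\<Sum>\<pi> | \<pi> permutes {1..n}. \<Sum>h\<in>?W. if sorts n \<pi> h then G h else 0)"
  proof (rule sum.cong)
    fix \<pi> assume "\<pi> \<in> {\<pi>. \<pi> permutes {1..n}}"
    then have \<pi>: "\<pi> permutes {1..n}" by simp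
    have "F \<pi> * card (enriched n (inv \<pi>) m) = (\<Sum>h\<in>{h \<in> ?W. sorts n \<pi> h}. F \<pi>)"
      by (simp add: card_enriched_inv[OF \<pi>])
    also have "\<dots> = (\<Sum>h\<in>{h \<in> ?W. sorts n \<pi> h}. G h)"
      by (rule sum.cong) (auto simp: assms[OF \<pi>])
    also have "\<dots> = (\<Sum>h\<in>?W. if sorts n \<pi> h then G h else 0)"
      by (rule sum.inter_filter[OF fin])
    finally show "F \<pi> * card (enriched n (inv \<pi>) m) = (\<Sum>h\<in>?W. if sorts n \<pi> h then G h else 0)" .
  qed simp
  also have "\<dots> = (\<Sum>h\<in>?W. \<Sum>\<pi> | \<pi> permutes {1..n}. if sorts n \<pi> h then G h else 0)"
    by (rule sum.swap)
  also have "\<dots> = (\<Sum>h\<in>?W. G h)"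
  proof (rule sum.cong)
    fix h
    obtain \<pi> where \<pi>: "{\<pi>. \<pi> permutes {1..n} \<and> sorts n \<pi> h} = {\<pi>}"
      using ex1_sorts[of n h] by (auto simp: set_eq_iff)
    have "(\<Sum>\<pi> | \<pi> permutes {1..n}. if sorts n \<pi> h then G h else 0) =
        (\<Sum>\<pi>\<in>{\<pi> \<in> {\<pi>. \<pi> permutes {1..n}}. sorts n \<pi> h}. G h)"
      by (rule sum.inter_filter[OF finP, symmetric])
    then show "(\<Sum>\<pi> | \<pi> permutes {1..n}. if sorts n \<pi> h then G h else 0) = G h"
      using \<pi> by simp
  qed simp
  finally show ?thesis .
qed

lemma sum_card_enriched:
  "(\<Sum>\<pi> | \<pi> permutes {1..n}. card (enriched n \<pi> m)) = (2 * m) ^ n"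
proof -
  have "(\<Sum>\<pi> | \<pi> permutes {1..n}. card (enriched n \<pi> m)) =
      (\<Sum>\<pi> | \<pi> permutes {1..n}. 1 * card (enriched n (inv \<pi>) m))"
    by (rule sum.reindex_bij_witness[where i = inv and j = inv])
       (auto simp: permutes_inv permutes_inv_inv)
  also have "\<dots> = (\<Sum>h\<in>{1..n} \<rightarrow>\<^sub>E {..<2 * m}. 1)"
    by (rule sum_card_enriched_inv) simp
  also have "\<dots> = (2 * m) ^ n"
    by (simp add: card_PiE)
  finally show ?thesis .
qed

section \<open>Products of counts for a permutation and its inverse\<close>

text \<open>A word \<open>h\<close> sorted by \<open>\<pi>\<close> shows where \<open>\<pi>\<close>
  ascends, so the sum counts pairs of words \<open>h\<close> and \<open>f\<close> in which
  \<open>f\<close> obeys the repetition rule visible in \<open>h\<close>. Such a pair is one chain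
  in the letters (\<open>f i\<close>, \<open>h i\<close>), compared by \<open>f i\<close>
  first.\<close>

lemma sum_card_enriched_mult_inv:
  "(\<Sum>\<pi> | \<pi> permutes {1..n}. card (enriched n \<pi> a) * card (enriched n (inv \<pi>) b)) =
    card (chains (\<lambda>_. odd) n (2 * (2 * a * b)))"
proof -
  let ?A = "{1..n} \<rightarrow>\<^sub>E {..<2 * a}" and ?B = "{1..n} \<rightarrow>\<^sub>E {..<2 * b}"
  let ?C = "{1..n} \<rightarrow>\<^sub>E {..<2 * (2 * a * b)}"
  define up where "up h i \<longleftrightarrow> h i < h (Suc i) \<or> h i = h (Suc i) \<and> odd (h i)" for h :: "nat \<Rightarrow> nat" and i
  define H where "H h = chains (\<lambda>i c. odd c \<longleftrightarrow> up h i) n (2 * a)" for h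
  have "(\<Sum>\<pi> | \<pi> permutes {1..n}. card (enriched n \<pi> a) * card (enriched n (inv \<pi>) b)) =
      (\<Sum>h\<in>?B. card (H h))"
  proof (rule sum_card_enriched_inv)
    fix \<pi> h assume "sorts n \<pi> h"
    then have "\<pi> i < \<pi> (Suc i) \<longleftrightarrow> up h i" if "i \<in> {1..<n}" for i
      using that by (auto simp: sorts_def up_def)
    then have "enriched n \<pi> a = H h"
      by (auto simp: enriched_def H_def chains_def)
    then show "card (enriched n \<pi> a) = card (H h)" by simp
  qed
  also have "\<dots> = card (Sigma ?B H)"
    by (subst card_SigmaI) (auto simp: H_def finite_chains intro: finite_PiE)
  also have "\<dots> = card (chains (\<lambda>_. odd) n (2 * (2 * a * b)))"
  proof -
    \<comment> \<open>Row \<open>x\<close> is read backwards for negative \<open>x\<close>, which makes \<open>enc x y\<close> odd exactly when \<open>x\<close> and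
      \<open>y\<close> have equal sign.\<close>
    define enc where "enc x y = 2 * b * x + (if odd x then y else 2 * b - 1 - y)" for x y
    define decy where "decy r = (if odd (r div (2 * b)) then r mod (2 * b)
      else 2 * b - 1 - r mod (2 * b))" for r
    have lt: "enc x y < 2 * (2 * a * b)" if "x < 2 * a" "y < 2 * b" for x y
    proof -
      have "enc x y < 2 * b * x + 2 * b" using that by (auto simp: enc_def)
      also have "\<dots> = 2 * b * Suc x" by simp
      also have "\<dots> \<le> 2 * b * (2 * a)" using that by (intro mult_le_mono2) auto
      finally show ?thesis by (simp add: mult_ac)
    qed
    have enc_div: "enc x y div (2 * b) = x" and enc_mod: "decy (enc x y) = y" if "y < 2 * b" for x y
    proof -
      have *: "(if odd x then y else 2 * b - 1 - y) < 2 * b" using that by auto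
      show d: "enc x y div (2 * b) = x" unfolding enc_def using * that
        by (subst div_mult_self4) auto
      have "enc x y mod (2 * b) = (if odd x then y else 2 * b - 1 - y)"
        unfolding enc_def using * by (simp only: mod_mult_self4 mod_less)
      then show "decy (enc x y) = y" using that d by (auto simp: decy_def)
    qed
    have dec: "r div (2 * b) < 2 * a" "decy r < 2 * b" "enc (r div (2 * b)) (decy r) = r"
      if "r < 2 * (2 * a * b)" for r
    proof -
      have b: "b > 0" using that by (cases b) auto
      show "r div (2 * b) < 2 * a" using that b by (simp add: less_mult_imp_div_less mult_ac)
      have m: "r mod (2 * b) < 2 * b" using b by simp
      then show "decy r < 2 * b" unfolding decy_def by (auto simp only: split: if_splits)
      have "(if odd (r div (2 * b)) then decy r else 2 * b - 1 - decy r) = r mod (2 * b)"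
        unfolding decy_def using m by auto
      then show "enc (r div (2 * b)) (decy r) = r"
        unfolding enc_def by simp
    qed
    \<comment> \<open>The chain condition for encoded letters is the one for \<open>f\<close> under
      the rule set by \<open>h\<close>; this makes the two sets correspond.\<close>
    have order: "(enc x y < enc x' y' \<or> enc x y = enc x' y' \<and> odd (enc x y)) \<longleftrightarrow>
        x < x' \<or> x = x' \<and> (odd x \<longleftrightarrow> y < y' \<or> y = y' \<and> odd y)"
      if "y < 2 * b" "y' < 2 * b" for x y x' y'
    proof -
      have less: "enc x y < enc x' y'" if "x < x'" "y < 2 * b" "y' < 2 * b" for x y x' y'
      proof -
        have "enc x y < 2 * b * Suc x" using that by (auto simp: enc_def)
        also have "\<dots> \<le> 2 * b * x'" using that by (intro mult_le_mono2) auto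
        also have "\<dots> \<le> enc x' y'" by (simp add: enc_def)
        finally show ?thesis .
      qed
      consider "x < x'" | "x' < x" | "x = x'" by linarith
      then show ?thesis
      proof cases
        case 1
        then show ?thesis using less[of x x' y y'] that by simp
      next
        case 2
        then show ?thesis using less[of x' x y' y] that by simp
      next
        case 3
        \<comment> \<open>Reading a row backwards reverses the order and, as
          \<open>2 * b - 1\<close> is odd, flips the parity. The bounds on \<open>y\<close> and
          \<open>y'\<close> keep the subtraction from truncating.\<close>
        have "2 * b - 1 - y < 2 * b - 1 - y' \<longleftrightarrow> y' < y" "2 * b - 1 - y = 2 * b - 1 - y' \<longleftrightarrow> y = y'"
          "odd (2 * b - 1 - y) \<longleftrightarrow> even y"
          using that by auto
        then show ?thesis using 3 by (cases y y' rule: linorder_cases) (simp_all add: enc_def)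
      qed
    qed
    have "bij_betw (\<lambda>(h, f). \<lambda>i\<in>{1..n}. enc (f i) (h i)) (Sigma ?B H)
        (chains (\<lambda>_. odd) n (2 * (2 * a * b)))"
    proof (rule bij_betw_byWitness[where
          f' = "\<lambda>r. (\<lambda>i\<in>{1..n}. decy (r i), \<lambda>i\<in>{1..n}. r i div (2 * b))"])
      show "\<forall>p\<in>Sigma ?B H. (\<lambda>r. (\<lambda>i\<in>{1..n}. decy (r i), \<lambda>i\<in>{1..n}. r i div (2 * b)))
          ((\<lambda>(h, f). \<lambda>i\<in>{1..n}. enc (f i) (h i)) p) = p"
      proof (rule ballI)
        fix p assume "p \<in> Sigma ?B H"
        then obtain h f where p: "p = (h, f)" and h: "h \<in> ?B" and f: "f \<in> H h" by blast
        then have f': "f \<in> ?A" by (simp add: H_def chains_def)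
        have "(\<lambda>i\<in>{1..n}. decy ((\<lambda>i\<in>{1..n}. enc (f i) (h i)) i)) = h"
        proof
          fix i
          show "(\<lambda>i\<in>{1..n}. decy ((\<lambda>i\<in>{1..n}. enc (f i) (h i)) i)) i = h i"
            using PiE_arb[OF h, of i] PiE_mem[OF h, of i] enc_mod[of "h i" "f i"]
            by (cases "i \<in> {1..n}") simp_all
        qed
        moreover have "(\<lambda>i\<in>{1..n}. (\<lambda>i\<in>{1..n}. enc (f i) (h i)) i div (2 * b)) = f"
        proof
          fix i
          show "(\<lambda>i\<in>{1..n}. (\<lambda>i\<in>{1..n}. enc (f i) (h i)) i div (2 * b)) i = f i"
            using PiE_arb[OF f', of i] PiE_mem[OF h, of i] enc_div[of "h i" "f i"]
            by (cases "i \<in> {1..n}") simp_all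
        qed
        ultimately show "(\<lambda>r. (\<lambda>i\<in>{1..n}. decy (r i), \<lambda>i\<in>{1..n}. r i div (2 * b)))
          ((\<lambda>(h, f). \<lambda>i\<in>{1..n}. enc (f i) (h i)) p) = p"
          unfolding p by simp
      qed
      show "\<forall>r\<in>chains (\<lambda>_. odd) n (2 * (2 * a * b)).
          (\<lambda>(h, f). \<lambda>i\<in>{1..n}. enc (f i) (h i))
            (\<lambda>i\<in>{1..n}. decy (r i), \<lambda>i\<in>{1..n}. r i div (2 * b)) = r"
      proof (rule ballI)
        fix r assume "r \<in> chains (\<lambda>_. odd) n (2 * (2 * a * b))"
        then have r: "r \<in> ?C" unfolding chains_def by blast
        have "(\<lambda>i\<in>{1..n}. enc ((\<lambda>i\<in>{1..n}. r i div (2 * b)) i) ((\<lambda>i\<in>{1..n}. decy (r i)) i)) = r"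
        proof
          fix i
          show "(\<lambda>i\<in>{1..n}. enc ((\<lambda>i\<in>{1..n}. r i div (2 * b)) i) ((\<lambda>i\<in>{1..n}. decy (r i)) i)) i
              = r i"
            using PiE_arb[OF r, of i] PiE_mem[OF r, of i] dec(3)[of "r i"]
            by (cases "i \<in> {1..n}") simp_all
        qed
        then show "(\<lambda>(h, f). \<lambda>i\<in>{1..n}. enc (f i) (h i))
            (\<lambda>i\<in>{1..n}. decy (r i), \<lambda>i\<in>{1..n}. r i div (2 * b)) = r"
          by simp
      qed
      show "(\<lambda>(h, f). \<lambda>i\<in>{1..n}. enc (f i) (h i)) ` Sigma ?B H
          \<subseteq> chains (\<lambda>_. odd) n (2 * (2 * a * b))"
      proof (rule image_subsetI)
        fix p assume "p \<in> Sigma ?B H"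
        then obtain h f where p: "p = (h, f)" and h: "h \<in> ?B" and f: "f \<in> H h" by blast
        then have f': "f \<in> ?A" by (simp add: H_def chains_def)
        have hb: "h i < 2 * b" if "i \<in> {1..n}" for i using PiE_mem[OF h, of i] that by simp
        have fa: "f i < 2 * a" if "i \<in> {1..n}" for i using PiE_mem[OF f' that] by simp
        have "enc (f i) (h i) < enc (f (Suc i)) (h (Suc i)) \<or>
            enc (f i) (h i) = enc (f (Suc i)) (h (Suc i)) \<and> odd (enc (f i) (h i))"
          if "i \<in> {1..<n}" for i
          using f that by (subst order) (auto simp: H_def chains_def up_def intro!: hb)
        then show "(\<lambda>(h, f). \<lambda>i\<in>{1..n}. enc (f i) (h i)) p \<in> chains (\<lambda>_. odd) n (2 * (2 * a * b))"
          using lt[OF fa hb] by (auto simp: p chains_def)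
      qed
      show "(\<lambda>r. (\<lambda>i\<in>{1..n}. decy (r i), \<lambda>i\<in>{1..n}. r i div (2 * b))) `
          chains (\<lambda>_. odd) n (2 * (2 * a * b)) \<subseteq> Sigma ?B H"
      proof (rule image_subsetI)
        fix r assume r: "r \<in> chains (\<lambda>_. odd) n (2 * (2 * a * b))"
        then have rC: "r \<in> ?C" unfolding chains_def by blast
        have rlt: "r i < 2 * (2 * a * b)" if "i \<in> {1..n}" for i
          using PiE_mem[OF rC that] by simp
        have "r i div (2 * b) < r (Suc i) div (2 * b) \<or> r i div (2 * b) = r (Suc i) div (2 * b) \<and>
            (odd (r i div (2 * b)) \<longleftrightarrow> decy (r i) < decy (r (Suc i)) \<or>
               decy (r i) = decy (r (Suc i)) \<and> odd (decy (r i)))"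
          if "i \<in> {1..<n}" for i
          using r that dec[OF rlt, of i] dec[OF rlt, of "Suc i"]
            order[of "decy (r i)" "decy (r (Suc i))" "r i div (2 * b)" "r (Suc i) div (2 * b)"]
          by (auto simp: chains_def)
        then show "(\<lambda>i\<in>{1..n}. decy (r i), \<lambda>i\<in>{1..n}. r i div (2 * b)) \<in> Sigma ?B H"
          using dec(1,2)[OF rlt] by (auto simp: H_def chains_def up_def)
      qed
    qed
    then show ?thesis by (rule bij_betw_same_card)
  qed
  finally show ?thesis .
qed

section \<open>The generating function of enriched words in terms of peaks\<close>

definition R_fps :: "'a::field_char_0 fps" where
  "R_fps = (1 + fps_X) * inverse (1 - fps_X)"

definition T_fps :: "'a::field_char_0 fps" where
  "T_fps = 4 * fps_X * inverse (1 + fps_X) ^ 2"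

lemma inverse_one_minus_X: "(1 - fps_X) * inverse (1 - fps_X) = (1 :: 'a::field_char_0 fps)"
  by (rule inverse_mult_eq_1') simp

lemma inverse_one_plus_X: "(1 + fps_X) * inverse (1 + fps_X) = (1 :: 'a::field_char_0 fps)"
  by (rule inverse_mult_eq_1') simp

lemma R_squared_times_one_minus_T: "R_fps ^ 2 * (1 - T_fps) = (1 :: 'a::field_char_0 fps)"
proof -
  define D I :: "'a fps" where "D = inverse (1 - fps_X)" and "I = inverse (1 + fps_X)"
  have "(1 - fps_X) * D = 1" "(1 + fps_X) * I = 1"
    by (simp_all add: D_def I_def inverse_one_minus_X inverse_one_plus_X)
  then show ?thesis
    unfolding R_fps_def T_fps_def D_def[symmetric] I_def[symmetric] by algebra
qed

lemma R_fps_nonzero: "R_fps \<noteq> (0 :: 'a::field_char_0 fps)"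
  using R_squared_times_one_minus_T[where 'a = 'a] by auto

text \<open>Each factor \<open>1 - T_fps\<close> cancels one \<open>R_fps ^ 2\<close>. This gives
  the series of degrees \<open>k\<close> and \<open>n\<close> the common factor
  \<open>R_fps ^ (n + 1)\<close>.\<close>

lemma R_power_eq:
  assumes "k \<le> n" "even (n - k)"
  shows "R_fps ^ (k + 1) = (R_fps ^ (n + 1) * (1 - T_fps) ^ ((n - k) div 2) :: 'a::field_char_0 fps)"
proof -
  from assms have "n + 1 = (k + 1) + 2 * ((n - k) div 2)" by auto
  then have "R_fps ^ (n + 1) = (R_fps ^ (k + 1) * (R_fps ^ 2) ^ ((n - k) div 2) :: 'a fps)"
    by (metis power_add power_mult)
  then have "R_fps ^ (n + 1) * (1 - T_fps) ^ ((n - k) div 2) =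
      (R_fps ^ (k + 1) * (R_fps ^ 2 * (1 - T_fps)) ^ ((n - k) div 2) :: 'a fps)"
    by (simp only: power_mult_distrib mult.assoc)
  then show ?thesis by (simp only: R_squared_times_one_minus_T power_one mult_1_right)
qed

text \<open>One more position can only turn position \<open>n + 1\<close> into a peak;
  \<open>0 < n\<close> rules out the first position, which has no left neighbour.\<close>

lemma pk_Suc:
  "pk (Suc (Suc n)) \<pi> =
     pk (Suc n) \<pi> + (if 0 < n \<and> \<pi> n < \<pi> (Suc n) \<and> \<pi> (Suc (Suc n)) < \<pi> (Suc n) then 1 else 0)"
proof -
  have "{i \<in> {2..Suc (Suc n) - 1}. \<pi> (i - 1) < \<pi> i \<and> \<pi> i > \<pi> (i + 1)} =
    {i \<in> {2..Suc n - 1}. \<pi> (i - 1) < \<pi> i \<and> \<pi> i > \<pi> (i + 1)} \<union>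
      (if 0 < n \<and> \<pi> n < \<pi> (Suc n) \<and> \<pi> (Suc (Suc n)) < \<pi> (Suc n) then {Suc n} else {})"
    by (auto simp: le_Suc_eq)
  then show ?thesis
    unfolding pk_def by (auto simp: card_insert_if)
qed

text \<open>Raising \<open>m\<close> by 1 adds the letters \<open>2 * m\<close> and
  \<open>2 * m + 1\<close>, so the sums S and the increments F satisfy S = X S + X F.\<close>

lemma fps_partial_sums_pairs:
  fixes N :: "nat \<Rightarrow> nat"
  shows "Abs_fps (\<lambda>m. of_nat (\<Sum>b<2*m. N b) :: 'a::field_char_0) =
    fps_X * inverse (1 - fps_X) *
      (Abs_fps (\<lambda>m. of_nat (N (2 * m))) + Abs_fps (\<lambda>m. of_nat (N (2 * m + 1))))"
    (is "?S = fps_X * ?D * ?F")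
proof -
  have "?S = fps_X * ?S + fps_X * ?F"
  proof (rule fps_ext)
    fix m show "?S $ m = (fps_X * ?S + fps_X * ?F) $ m"
      by (cases m) simp_all
  qed
  then have "(1 - fps_X) * ?S = fps_X * ?F" by (simp add: algebra_simps)
  then have "?D * ((1 - fps_X) * ?S) = ?D * (fps_X * ?F)" by (rule arg_cong)
  then have "(1 - fps_X) * ?D * ?S = fps_X * ?D * ?F"
    by (simp only: mult_ac)
  then show ?thesis by (simp only: inverse_one_minus_X mult_1)
qed

text \<open>Appending a position multiplies the series of words, graded by the pair that holds the
  last letter, by \<open>R_fps\<close>, and also by \<open>T_fps\<close> exactly when a peak is
  completed.\<close>

lemma enriched_gf:
  assumes \<pi>: "inj \<pi>"
  shows "Abs_fps (\<lambda>m. of_nat (card (enriched (Suc n) \<pi> m)) :: 'a::field_char_0) =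
    fps_const (1/2) * R_fps ^ (Suc n + 1) * T_fps ^ (pk (Suc n) \<pi> + 1)"
proof -
  define N where "N k = chains_ending (\<lambda>i c. odd c \<longleftrightarrow> \<pi> i < \<pi> (Suc i)) (Suc k)" for k
  define F0 :: "nat \<Rightarrow> 'a fps" where "F0 k = Abs_fps (\<lambda>m. of_nat (N k (2 * m)))" for k
  define F1 :: "nat \<Rightarrow> 'a fps" where "F1 k = Abs_fps (\<lambda>m. of_nat (N k (2 * m + 1)))" for k
  define D I :: "'a fps" where "D = inverse (1 - fps_X)" and "I = inverse (1 + fps_X)"
  define S where "S k = F0 k + F1 k" for k
  have D: "(1 - fps_X) * D = 1" and I: "(1 + fps_X) * I = 1"
    by (simp_all add: D_def I_def inverse_one_minus_X inverse_one_plus_X)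
  have R: "R_fps = (1 + fps_X) * D" and T: "T_fps = 4 * fps_X * I ^ 2"
    by (simp_all add: R_fps_def T_fps_def D_def I_def)
  have ps: "Abs_fps (\<lambda>m. of_nat (\<Sum>b<2*m. N k b)) = fps_X * D * S k" for k
    unfolding S_def F0_def F1_def D_def by (rule fps_partial_sums_pairs)
  have F0_Suc: "F0 (Suc k) = fps_X * D * S k + (if \<pi> (Suc k) < \<pi> (Suc (Suc k)) then 0 else F0 k)" for k
    by (rule fps_ext) (simp add: N_def F0_def flip: ps)
  \<comment> \<open>The extra term \<open>F0 k\<close> is there because the letter
    \<open>2 * m\<close> lies below \<open>2 * m + 1\<close>.\<close>
  have F1_Suc: "F1 (Suc k) = fps_X * D * S k + F0 k + (if \<pi> (Suc k) < \<pi> (Suc (Suc k)) then F1 k else 0)" for k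
    by (rule fps_ext) (simp add: N_def F0_def F1_def flip: ps)
  \<comment> \<open>The ratio of \<open>F0 k\<close> and \<open>F1 k\<close> depends only on whether the last step was an ascent; the first
    letter behaves as if preceded by a descent.\<close>
  have "(if 0 < k \<and> \<pi> k < \<pi> (Suc k) then F0 k = fps_X * F1 k else F0 k = F1 k) \<and>
      S k = 2 * D * R_fps ^ k * T_fps ^ pk (Suc k) \<pi>" for k
  proof (induction k)
    case 0
    have "D = Abs_fps (\<lambda>_. 1)"
      unfolding D_def by (rule fps_inverse_unique) (auto simp: fps_eq_iff algebra_simps)
    then have "F0 0 = D" "F1 0 = D"
      by (simp_all add: F0_def F1_def N_def)
    then show ?case by (simp add: S_def pk_def)
  next
    case (Suc k)
    show ?case
    proof (cases "\<pi> (Suc k) < \<pi> (Suc (Suc k))")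
      case True
      have 1: "F0 (Suc k) = fps_X * D * S k" using F0_Suc True by simp
      have 2: "F1 (Suc k) = D * S k"
      proof -
        have "F1 (Suc k) = fps_X * D * S k + S k"
          using F1_Suc[of k] True by (simp add: S_def)
        then show ?thesis using D by algebra
      qed
      have "S (Suc k) = S k * R_fps" unfolding S_def[of "Suc k"] 1 2 R by algebra
      then show ?thesis using True Suc.IH 1 2 by (simp add: pk_Suc algebra_simps)
    next
      case False
      with \<pi> have gt: "\<pi> (Suc (Suc k)) < \<pi> (Suc k)"
        by (metis injD less_linear n_not_Suc_n)
      have 1: "F0 (Suc k) = fps_X * D * S k + F0 k" "F1 (Suc k) = fps_X * D * S k + F0 k"
        using F0_Suc F1_Suc False by simp_all
      show ?thesis
      proof (cases "0 < k \<and> \<pi> k < \<pi> (Suc k)")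
        case asc: True
        then have F: "F0 k = fps_X * F1 k" using Suc.IH by simp
        \<comment> \<open>A peak is completed: \<open>F0 k\<close> is the share X / (1 + X) of
          \<open>S k\<close> instead of one half, which changes the factor from R to R T.\<close>
        have "S (Suc k) = S k * R_fps * T_fps"
          unfolding S_def[of "Suc k"] 1 R T unfolding S_def F using D I by algebra
        then show ?thesis using asc gt False Suc.IH 1 by (simp add: pk_Suc algebra_simps)
      next
        case nasc: False
        then have F: "F0 k = F1 k" using Suc.IH by auto
        have "S (Suc k) = S k * R_fps"
          unfolding S_def[of "Suc k"] 1 R unfolding S_def F using D by algebra
        then show ?thesis using nasc gt False Suc.IH 1 by (auto simp add: pk_Suc algebra_simps)
      qed
    qed
  qed
  then have S: "S n = 2 * D * R_fps ^ n * T_fps ^ pk (Suc n) \<pi>" by blast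
  \<comment> \<open>Summing over the last letter supplies X D. With the initial 2 D it yields the
    factor 1/2, two powers of R and the 1 added to the number of peaks.\<close>
  have half: "2 * fps_X * D ^ 2 = fps_const (1/2) * R_fps ^ 2 * T_fps"
  proof -
    have "R_fps ^ 2 * T_fps = 4 * fps_X * D ^ 2" unfolding R T using I by algebra
    then have "fps_const (1/2) * R_fps ^ 2 * T_fps = fps_const (1/2) * 4 * (fps_X * D ^ 2)"
      by (simp add: mult.assoc)
    also have "fps_const (1/2) * 4 = (2 :: 'a fps)"
      by (simp add: numeral_fps_const)
    finally show ?thesis by (simp add: mult.assoc)
  qed
  have "Abs_fps (\<lambda>m. of_nat (card (enriched (Suc n) \<pi> m)) :: 'a) = fps_X * D * S n"
    unfolding ps[symmetric] N_def enriched_def card_chains ..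
  also have "\<dots> = (2 * fps_X * D ^ 2) * (R_fps ^ n * T_fps ^ pk (Suc n) \<pi>)"
    unfolding S by (simp add: algebra_simps power2_eq_square)
  also have "\<dots> = fps_const (1/2) * R_fps ^ (Suc n + 1) * T_fps ^ (pk (Suc n) \<pi> + 1)"
    unfolding half by (simp add: algebra_simps power2_eq_square)
  finally show ?thesis .
qed

section \<open>From identities in the alphabet size to peak polynomials\<close>

text \<open>Substituting a nonzero series without constant term is injective. Hence a polynomial
  identity that holds at \<open>T_fps\<close> holds identically.\<close>

lemma T_fps_compose_eq_0:
  assumes "fps_of_poly Q oo T_fps = (0 :: 'a::field_char_0 fps)"
  shows "Q = 0"
proof -
  have T0: "T_fps $ 0 = (0 :: 'a)" by (simp add: T_fps_def)
  have "(T_fps :: 'a fps) \<noteq> 0"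
  proof
    assume "(T_fps :: 'a fps) = 0"
    then have "0 = (4 * fps_X * ((1 + fps_X) * inverse (1 + fps_X)) ^ 2 :: 'a fps)"
      by (simp add: T_fps_def power_mult_distrib)
    then have "(4 * fps_X :: 'a fps) = 0" by (simp add: inverse_one_plus_X)
    then show False by (simp add: numeral_fps_const)
  qed
  then have "fps_of_poly Q = 0"
    using assms T0 by (auto simp: fps_compose_eq_0_iff)
  then show ?thesis by (metis fps_of_poly_0 fps_of_poly_eq_iff)
qed

text \<open>Multiplying \<open>eq\<close> by X^m and summing over m gives two series with the common
  factor 1/2 R^(n+1). Cancelling it leaves the claim at \<open>T_fps\<close> in place of
  \<open>t\<close>, hence an identity of polynomials. This serves once for each variable.\<close>

lemma peak_transfer:
  fixes c f :: "_ \<Rightarrow> 'a::field_char_0"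
  assumes n: "0 < n" and p: "\<And>i. i \<in> J \<Longrightarrow> inj (p i)"
    and K: "K \<subseteq> {k \<in> {1..n}. even (n - k)}"
    and eq: "\<And>m. (\<Sum>i\<in>J. c i * of_nat (card (enriched n (p i) m))) =
      (\<Sum>k\<in>K. f k * of_nat (2 * m) ^ k)"
  shows "(\<Sum>i\<in>J. c i * t ^ (pk n (p i) + 1)) =
    (\<Sum>k\<in>K. f k * (1 - t) ^ ((n - k) div 2) * P_pk k t)"
proof -
  define Q where "Q = (\<Sum>i\<in>J. [:c i:] * [:0, 1:] ^ (pk n (p i) + 1)) -
    (\<Sum>k\<in>K. [:f k:] * (1 - [:0, 1:]) ^ ((n - k) div 2) * P_pk k [:0, 1:])"
  let ?h = "fps_const (1/2) :: 'a fps"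
  have gf: "Abs_fps (\<lambda>m. of_nat (card (enriched k \<pi> m)) :: 'a) =
      ?h * R_fps ^ (k + 1) * T_fps ^ (pk k \<pi> + 1)" if "0 < k" "inj \<pi>" for k \<pi>
    using enriched_gf[OF that(2), of "k - 1"] that(1) by simp
  have T0: "T_fps $ 0 = (0 :: 'a)" by (simp add: T_fps_def)
  \<comment> \<open>Summed over all permutations, the counts give (2m)^k. The case
    \<open>k = 0\<close> stays out: the series of the constant 1 is 1 / (1 - X), not half of
    R.\<close>
  have pow: "Abs_fps (\<lambda>m. of_nat (2 * m) ^ k :: 'a) = ?h * R_fps ^ (k + 1) * P_pk k T_fps"
    if "0 < k" for k
  proof -
    have "Abs_fps (\<lambda>m. of_nat (2 * m) ^ k :: 'a) =
        (\<Sum>\<pi> | \<pi> permutes {1..k}. Abs_fps (\<lambda>m. of_nat (card (enriched k \<pi> m))))"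
      by (rule fps_ext)
         (simp only: fps_nth_Abs_fps fps_sum_nth sum_card_enriched flip: of_nat_power of_nat_sum)
    also have "\<dots> = (\<Sum>\<pi> | \<pi> permutes {1..k}. ?h * R_fps ^ (k + 1) * T_fps ^ (pk k \<pi> + 1))"
      by (rule sum.cong) (use that in \<open>auto simp: gf permutes_inj simp del: power_Suc\<close>)
    finally show ?thesis using that by (simp add: P_pk_def sum_distrib_left)
  qed
  have "?h * R_fps ^ (n + 1) * (\<Sum>i\<in>J. fps_const (c i) * T_fps ^ (pk n (p i) + 1)) =
      (\<Sum>i\<in>J. fps_const (c i) * Abs_fps (\<lambda>m. of_nat (card (enriched n (p i) m))))"
    unfolding sum_distrib_left by (rule sum.cong) (simp_all add: gf[OF n p] mult_ac)
  also have "\<dots> = (\<Sum>k\<in>K. fps_const (f k) * Abs_fps (\<lambda>m. of_nat (2 * m) ^ k))"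
    by (rule fps_ext) (simp add: fps_sum_nth eq)
  also have "\<dots> = ?h * R_fps ^ (n + 1) *
      (\<Sum>k\<in>K. fps_const (f k) * (1 - T_fps) ^ ((n - k) div 2) * P_pk k T_fps)"
    unfolding sum_distrib_left
  proof (rule sum.cong)
    fix k assume "k \<in> K"
    with K have k: "0 < k" "k \<le> n" "even (n - k)" by auto
    show "fps_const (f k) * Abs_fps (\<lambda>m. of_nat (2 * m) ^ k) = ?h * R_fps ^ (n + 1) *
      (fps_const (f k) * (1 - T_fps) ^ ((n - k) div 2) * P_pk k T_fps)"
      unfolding pow[OF k(1)] R_power_eq[OF k(2,3)] by (simp add: mult_ac)
  qed simp
  finally have "(\<Sum>i\<in>J. fps_const (c i) * T_fps ^ (pk n (p i) + 1)) =
      (\<Sum>k\<in>K. fps_const (f k) * (1 - T_fps) ^ ((n - k) div 2) * P_pk k T_fps)"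
    by (simp add: R_fps_nonzero)
  \<comment> \<open>\<open>P_pk\<close> makes sense over any commutative ring, so its value at the
    indeterminate is the peak polynomial itself, to be evaluated at \<open>T_fps\<close> and at
    \<open>t\<close>.\<close>
  moreover have "fps_of_poly (P_pk k [:0, 1:]) oo T_fps = P_pk k (T_fps :: 'a fps)" for k
    using T0 by (simp add: P_pk_def fps_of_poly_sum fps_of_poly_power fps_compose_sum_distrib
      del: power_Suc flip: fps_compose_power)
  ultimately have "fps_of_poly Q oo T_fps = 0"
    using T0 unfolding Q_def by (simp add: fps_of_poly_sum fps_of_poly_mult fps_of_poly_power
      fps_of_poly_diff fps_of_poly_const fps_compose_sum_distrib fps_compose_sub_distrib
      fps_compose_mult_distrib del: power_Suc mult_pCons_left flip: fps_compose_power)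
  then have "Q = 0" by (rule T_fps_compose_eq_0)
  then have "poly Q t = 0" by simp
  moreover have "poly (P_pk k [:0, 1:]) t = P_pk k t" for k
    by (simp add: P_pk_def poly_sum poly_power)
  ultimately show ?thesis
    by (simp add: Q_def poly_sum poly_power mult_ac)
qed

section \<open>Powers of R and of the series L\<close>

text \<open>L is half the logarithm of R, taken as \<open>fps_ln 1\<close> at
  \<open>R_fps - 1\<close>, and the exponential of \<open>fps_ln 1\<close> is 1 + X.\<close>

lemma fps_exp_compose_L: "fps_exp 2 oo L_fps = (R_fps :: 'a::field_char_0 fps)"
proof -
  define g :: "'a fps" where "g = (1 + fps_X) / (1 - fps_X) - 1"
  have gR: "g = R_fps - 1"
    unfolding g_def R_fps_def by (subst fps_divide_unit) simp_all
  then have g0: "g $ 0 = 0" by (simp add: R_fps_def)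
  define l where "l = fps_ln 1 oo g"
  have l0: "l $ 0 = 0" by (simp add: l_def)
  have "fps_exp 2 oo L_fps = fps_exp 2 oo ((fps_const (1/2) * fps_X) oo l)"
    unfolding L_fps_eq_log g_def[symmetric] l_def[symmetric]
    using l0 by (simp add: fps_compose_mult_distrib)
  also have "\<dots> = fps_exp 1 oo l"
    using l0 by (subst fps_compose_assoc) simp_all
  also have "\<dots> = (fps_exp 1 oo fps_ln 1) oo g"
    unfolding l_def using g0 by (subst fps_compose_assoc) simp_all
  also have "fps_exp 1 oo fps_ln 1 = (1 + fps_X :: 'a fps)"
  proof -
    have "(fps_exp 1 - 1) oo fps_inv (fps_exp 1 - 1) = (fps_X :: 'a fps)"
      by (rule fps_inv_right) simp_all
    then show ?thesis
      by (simp add: fps_ln_fps_exp_inv fps_compose_sub_distrib algebra_simps)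
  qed
  finally show ?thesis
    using g0 by (simp add: fps_compose_add_distrib gR)
qed

lemma R_power_nth:
  "(R_fps ^ m) $ n = (\<Sum>k\<le>n. of_nat (2 * m) ^ k / fact k * (L_fps ^ k $ n) :: 'a::field_char_0)"
proof -
  have L0: "L_fps $ 0 = (0::'a)" by (simp add: L_fps_def)
  have "R_fps ^ m = (fps_exp (of_nat (2 * m)) oo L_fps :: 'a fps)"
    unfolding fps_exp_compose_L[symmetric] fps_compose_power[OF L0] fps_exp_power_mult
    by (simp add: mult.commute)
  then show ?thesis by (simp add: fps_compose_nth atLeast0AtMost)
qed

text \<open>L is odd, so replacing X by -X multiplies L^k by (-1)^k, while it multiplies the
  coefficient of X^n by (-1)^n.\<close>

lemma L_power_nth_eq_0:
  assumes "odd (n + k)"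
  shows "(L_fps ^ k $ n :: 'a::field_char_0) = 0"
proof -
  have "L_fps oo (fps_const (-1) * fps_X) = (- L_fps :: 'a fps)"
    by (rule fps_ext) (simp add: L_fps_def fps_compose_linear)
  then have "L_fps ^ k oo (fps_const (-1) * fps_X) = ((- L_fps) ^ k :: 'a fps)"
    by (subst fps_compose_power[symmetric]) simp_all
  then have "(-1) ^ n * (L_fps ^ k $ n) = ((- L_fps) ^ k :: 'a fps) $ n"
    by (simp add: fps_compose_linear fps_eq_iff)
  also have "(- L_fps) ^ k = (fps_const ((-1) ^ k) * L_fps ^ k :: 'a fps)"
    by (simp add: power_minus[of L_fps] flip: fps_const_power fps_const_neg)
  finally have "(-1) ^ n * (L_fps ^ k $ n) = (-1) ^ k * (L_fps ^ k $ n :: 'a)" by simp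
  then show ?thesis using assms by (cases "even n") auto
qed

section \<open>Comparison of coefficients\<close>

text \<open>This is the coefficient of u^n in the identity, free of square roots because only
  \<open>k\<close> of the parity of \<open>n\<close> occur.\<close>

lemma P_pk_ipk_eq:
  fixes s t :: "'a::field_char_0"
  assumes n: "0 < n"
  defines "K \<equiv> {k \<in> {1..n}. even (n - k)}"
  shows "P_pk_ipk n s t = (\<Sum>k\<in>K. L_fps ^ k $ n / fact k * ((1 - s) * (1 - t)) ^ ((n - k) div 2)
    * P_pk k s * P_pk k t)"
proof -
  let ?S = "{\<pi>. \<pi> permutes {1..n}}"
  have inj: "inj \<pi>" "inj (inv \<pi>)" if "\<pi> \<in> ?S" for \<pi>
    using that permutes_inj permutes_inv by blast+
  have main: "(\<Sum>\<pi>\<in>?S. of_nat (card (enriched n (inv \<pi>) b)) * of_nat (card (enriched n \<pi> a))) =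
      (\<Sum>k\<in>K. (L_fps ^ k $ n / fact k * of_nat (2 * b) ^ k) * of_nat (2 * a) ^ k :: 'a)" for a b
  proof -
    \<comment> \<open>One half of the 4ab letters may be repeated, so the count is a coefficient of
      R^(2ab), the exponential of 4ab L. As 4ab = (2b)(2a), the two alphabet sizes separate.\<close>
    have "(\<Sum>\<pi>\<in>?S. of_nat (card (enriched n (inv \<pi>) b)) * of_nat (card (enriched n \<pi> a))) =
        (of_nat (card (chains (\<lambda>_. odd) n (2 * (2 * a * b)))) :: 'a)"
      unfolding sum_card_enriched_mult_inv[symmetric] by (simp add: mult.commute)
    also have "\<dots> = (R_fps ^ (2 * a * b)) $ n"
      unfolding R_fps_def chains_gf_odd[symmetric] by (simp add: chains_gf_def)
    also have "\<dots> = (\<Sum>k\<le>n. of_nat (2 * (2 * a * b)) ^ k / fact k * (L_fps ^ k $ n))"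
      by (rule R_power_nth)
    also have "\<dots> = (\<Sum>k\<in>K. of_nat (2 * (2 * a * b)) ^ k / fact k * (L_fps ^ k $ n))"
    proof (rule sum.mono_neutral_right)
      show "\<forall>k\<in>{..n} - K. of_nat (2 * (2 * a * b)) ^ k / fact k * (L_fps ^ k $ n) = (0 :: 'a)"
      proof
        fix k assume k: "k \<in> {..n} - K"
        show "of_nat (2 * (2 * a * b)) ^ k / fact k * (L_fps ^ k $ n) = (0 :: 'a)"
        proof (cases "k = 0")
          case True
          then show ?thesis using n by simp
        next
          case False
          with k have "odd (n + k)" by (auto simp: K_def)
          then show ?thesis by (simp add: L_power_nth_eq_0)
        qed
      qed
    qed (auto simp: K_def)
    also have "\<dots> = (\<Sum>k\<in>K. (L_fps ^ k $ n / fact k * of_nat (2 * b) ^ k) * of_nat (2 * a) ^ k)"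
    proof (rule sum.cong)
      fix k
      have e: "(of_nat (2 * (2 * a * b)) :: 'a) = of_nat (2 * b) * of_nat (2 * a)" by simp
      show "of_nat (2 * (2 * a * b)) ^ k / fact k * (L_fps ^ k $ n) =
          (L_fps ^ k $ n / fact k * of_nat (2 * b) ^ k) * (of_nat (2 * a) ^ k :: 'a)"
        unfolding e power_mult_distrib by (simp add: field_simps del: of_nat_mult)
    qed simp
    finally show ?thesis .
  qed
  \<comment> \<open>First transfer: the counts for a fixed \<open>b\<close> are the weights, and the
    other alphabet size gives way to \<open>s\<close>. The second transfer then exchanges
    \<open>b\<close> for \<open>t\<close>.\<close>
  have "(\<Sum>\<pi>\<in>?S. of_nat (card (enriched n (inv \<pi>) b)) * s ^ (pk n \<pi> + 1)) =
      (\<Sum>k\<in>K. (L_fps ^ k $ n / fact k * of_nat (2 * b) ^ k) * (1 - s) ^ ((n - k) div 2) * P_pk k s)" for b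
    by (rule peak_transfer[OF n, where p = "\<lambda>\<pi>. \<pi>"]) (use main inj in \<open>auto simp: K_def\<close>)
  then have half: "(\<Sum>\<pi>\<in>?S. s ^ (pk n \<pi> + 1) * of_nat (card (enriched n (inv \<pi>) b))) =
      (\<Sum>k\<in>K. (L_fps ^ k $ n / fact k * (1 - s) ^ ((n - k) div 2) * P_pk k s) * of_nat (2 * b) ^ k)" for b
    by (simp add: mult_ac del: of_nat_mult)
  have "(\<Sum>\<pi>\<in>?S. s ^ (pk n \<pi> + 1) * t ^ (pk n (inv \<pi>) + 1)) =
      (\<Sum>k\<in>K. (L_fps ^ k $ n / fact k * (1 - s) ^ ((n - k) div 2) * P_pk k s) *
         (1 - t) ^ ((n - k) div 2) * P_pk k t)"
    by (rule peak_transfer[OF n, where p = inv]) (use half inj in \<open>auto simp: K_def\<close>)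
  then show ?thesis
    using n by (simp add: P_pk_ipk_def ipk_def power_mult_distrib mult_ac)
qed

text \<open>\<open>w\<close> may be either square root, since only even powers w^(n-k) survive; it
  is nonzero, so dividing by it is harmless. Convergence is coefficientwise.\<close>

theorem theorem3p5:
  fixes s t w :: "'a::field_char_0"
  assumes "s \<noteq> 1" and "t \<noteq> 1"
    and "w\<^sup>2 = (1 - s) * (1 - t)"
  shows "(\<lambda>k. fps_const (1 / fact k)
              * ((L_fps oo (fps_const w * fps_X)) / fps_const w) ^ k
              * fps_const (P_pk k s * P_pk k t))
         sums Abs_fps (\<lambda>n. P_pk_ipk n s t)"
proof -
  from assms have w: "w \<noteq> 0" by auto
  have L0: "L_fps $ 0 = (0::'a)" by (simp add: L_fps_def)
  define summand where "summand k = fps_const (1 / fact k)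
      * ((L_fps oo (fps_const w * fps_X)) / fps_const w) ^ k * fps_const (P_pk k s * P_pk k t)" for k
  have nth: "summand k $ n = L_fps ^ k $ n / fact k * (w ^ n / w ^ k) * P_pk k s * P_pk k t" for k n
  proof -
    have "((L_fps oo (fps_const w * fps_X)) / fps_const w) ^ k =
        (fps_const (1 / w) * (L_fps oo (fps_const w * fps_X))) ^ k"
      using w by (simp add: fps_divide_unit fps_const_inverse divide_inverse mult.commute)
    also have "\<dots> = fps_const (1 / w ^ k) * (L_fps ^ k oo (fps_const w * fps_X))"
      by (subst fps_compose_power[symmetric]) (simp_all add: power_mult_distrib power_one_over)
    finally show ?thesis
      by (simp add: summand_def fps_compose_linear)
  qed
  \<comment> \<open>As L^k starts at u^k, the coefficient of u^n is settled once the partial sum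
    contains all \<open>k\<close> up to \<open>n\<close>.\<close>
  have partial: "(\<Sum>k<N. summand k) $ n = P_pk_ipk n s t" if "n < N" for n N
  proof -
    have "(\<Sum>k<N. summand k) $ n = (\<Sum>k<N. summand k $ n)" by (simp add: fps_sum_nth)
    also have "\<dots> = P_pk_ipk n s t"
    proof (cases "n = 0")
      case True
      have "(\<Sum>k<N. summand k $ n) = (\<Sum>k\<in>{0}. summand k $ n)"
        by (rule sum.mono_neutral_right) (use that True in \<open>auto simp: nth L0 startsby_zero_power\<close>)
      then show ?thesis using True by (simp add: nth P_pk_def P_pk_ipk_def)
    next
      case False
      define K where "K = {k \<in> {1..n}. even (n - k)}"
      have "(\<Sum>k<N. summand k $ n) = (\<Sum>k\<in>K. summand k $ n)"
      proof (rule sum.mono_neutral_right)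
        show "\<forall>k\<in>{..<N} - K. summand k $ n = 0"
        proof
          fix k assume "k \<in> {..<N} - K"
          then consider "k = 0" | "n < k" | "odd (n + k)" by (fastforce simp: K_def)
          then have "L_fps ^ k $ n = (0 :: 'a)"
          proof cases
            case 2
            then show ?thesis using L0 by (simp add: startsby_zero_power_prefix)
          qed (use False in \<open>simp_all add: L_power_nth_eq_0\<close>)
          then show "summand k $ n = 0" by (simp add: nth)
        qed
      qed (use that in \<open>auto simp: K_def\<close>)
      also have "\<dots> = (\<Sum>k\<in>K. L_fps ^ k $ n / fact k * ((1 - s) * (1 - t)) ^ ((n - k) div 2)
          * P_pk k s * P_pk k t)"
      proof (rule sum.cong)
        fix k assume "k \<in> K"
        then have k: "k \<le> n" "even (n - k)" by (auto simp: K_def)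
        have "w ^ n / w ^ k = w ^ (n - k)" using w k(1) by (simp add: power_diff)
        also have "\<dots> = (w\<^sup>2) ^ ((n - k) div 2)" using k(2) by (metis dvd_mult_div_cancel power_mult)
        finally show "summand k $ n = L_fps ^ k $ n / fact k * ((1 - s) * (1 - t)) ^ ((n - k) div 2)
            * P_pk k s * P_pk k t"
          by (simp add: nth assms(3))
      qed simp
      also have "\<dots> = P_pk_ipk n s t"
        using False by (simp add: P_pk_ipk_eq K_def)
      finally show ?thesis .
    qed
    finally show ?thesis .
  qed
  have "summand sums Abs_fps (\<lambda>n. P_pk_ipk n s t)"
    unfolding sums_def
  proof (rule tendsto_fpsI)
    fix n
    show "\<forall>\<^sub>F N in sequentially. (\<Sum>k<N. summand k) $ n = Abs_fps (\<lambda>n. P_pk_ipk n s t) $ n"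
      using eventually_gt_at_top[of n] by eventually_elim (simp add: partial)
  qed
  then show ?thesis unfolding summand_def .
qed

end
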